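(* If $T$ is a finite tree, possibly weighted (with positive edge weights), then $$d_{BM}\bigl(\mathrm{TP}_{\mathcal{DP}}(T),\ell_\infty^{|E(T)|}\bigr)\le 4,$$ where $E(T)$ is the edge set of $T$.
   Context: The tree $T$ is regarded as a metric space on its vertex set, with $d(x,y)$ the sum of the weights (lengths) of the edges on the path joining $x$ and $y$ (all weights equal to $1$ in the unweighted case). For a metric space $(M,d)$, $\mathrm{TP}(M)$ is the real vector space of all finitely supported functions $f:M\to\mathbb{R}$ with $\sum_{v\in M}f(v)=0$. The double-point seminorm on $\mathrm{TP}(M)$ is $$\|f\|_{\mathcal{DP}}=\sup_{u,v\in M}\left|\sum_{x\in M}\frac{d(v,x)-d(u,x)}{2}\,f(x)\right|.$$ $\mathrm{TP}_{\mathcal{DP}}(M)$ is the completion of $(\mathrm{TP}(M),\|\cdot\|_{\mathcal{DP}})$ if this is a norm, and in general the completion of the quotient of $\mathrm{TP}(M)$ by the kernel of $\|\cdot\|_{\mathcal{DP}}$ with the induced norm. $d_{BM}(X,Y)=\inf\{\|D\|\,\|D^{-1}\|: D:X\to Y \text{ a linear isomorphism}\}$ is the (multiplicative) Banach–Mazur distance, and $\ell_\infty^n$ is $\mathbb{R}^n$ with the maximum norm. *)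

theory Defs
  imports "HOL-Analysis.Analysis"
begin

section \<open>Seminormed spaces with explicit carriers\<close>

text \<open>
  The spaces below depend on values (a tree, a dimension), so they cannot be types; they are
  records, and only the behaviour of the operations on the carrier matters.
\<close>

record 'v snspace =
  vecs :: "'v set"
  vadd :: "'v \<Rightarrow> 'v \<Rightarrow> 'v"
  vscale :: "real \<Rightarrow> 'v \<Rightarrow> 'v"
  vnorm :: "'v \<Rightarrow> real"

definition vdist :: "'v snspace \<Rightarrow> 'v \<Rightarrow> 'v \<Rightarrow> real" where
  "vdist X x y = vnorm X (vadd X x (vscale X (-1) y))"

definition function_space :: "('i \<Rightarrow> real) set \<Rightarrow> (('i \<Rightarrow> real) \<Rightarrow> real) \<Rightarrow> ('i \<Rightarrow> real) snspace" where
  "function_space F N =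
     \<lparr>vecs = F, vadd = (\<lambda>f g x. f x + g x), vscale = (\<lambda>r f x. r * f x), vnorm = N\<rparr>"


subsection \<open>Quotient by the kernel of the seminorm\<close>

text \<open>
  The seminorm is constant on each coset of its kernel, so the set of its values on a coset is a
  singleton. If the seminorm is a norm, the cosets are singletons.
\<close>

definition kernel_coset :: "'v snspace \<Rightarrow> 'v \<Rightarrow> 'v set" where
  "kernel_coset X x = {y \<in> vecs X. vdist X x y = 0}"

definition kernel_quotient :: "'v snspace \<Rightarrow> 'v set snspace" where
  "kernel_quotient X =
     \<lparr>vecs = kernel_coset X ` vecs X,
      vadd = (\<lambda>A B. \<Union>a\<in>A. \<Union>b\<in>B. kernel_coset X (vadd X a b)),
      vscale = (\<lambda>r A. \<Union>a\<in>A. kernel_coset X (vscale X r a)),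
      vnorm = (\<lambda>A. the_elem (vnorm X ` A))\<rparr>"


subsection \<open>Completion by classes of Cauchy sequences\<close>

definition cauchy_seqs :: "'v snspace \<Rightarrow> (nat \<Rightarrow> 'v) set" where
  "cauchy_seqs X = {s. (\<forall>n. s n \<in> vecs X) \<and>
     (\<forall>e>0. \<exists>N. \<forall>m\<ge>N. \<forall>n\<ge>N. vdist X (s m) (s n) < e)}"

definition cauchy_class :: "'v snspace \<Rightarrow> (nat \<Rightarrow> 'v) \<Rightarrow> (nat \<Rightarrow> 'v) set" where
  "cauchy_class X s = {t \<in> cauchy_seqs X. (\<lambda>n. vdist X (s n) (t n)) \<longlonglongrightarrow> 0}"

definition completion :: "'v snspace \<Rightarrow> (nat \<Rightarrow> 'v) set snspace" where
  "completion X =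
     \<lparr>vecs = cauchy_class X ` cauchy_seqs X,
      vadd = (\<lambda>A B. \<Union>s\<in>A. \<Union>t\<in>B. cauchy_class X (\<lambda>n. vadd X (s n) (t n))),
      vscale = (\<lambda>r A. \<Union>s\<in>A. cauchy_class X (\<lambda>n. vscale X r (s n))),
      vnorm = (\<lambda>A. the_elem ((\<lambda>s. lim (\<lambda>n. vnorm X (s n))) ` A))\<rparr>"


subsection \<open>The Banach--Mazur distance\<close>

definition linear_iso :: "'v snspace \<Rightarrow> 'u snspace \<Rightarrow> ('v \<Rightarrow> 'u) \<Rightarrow> bool" where
  "linear_iso X Y D \<longleftrightarrow>
     bij_betw D (vecs X) (vecs Y) \<and>
     (\<forall>x\<in>vecs X. \<forall>y\<in>vecs X. D (vadd X x y) = vadd Y (D x) (D y)) \<and>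
     (\<forall>r. \<forall>x\<in>vecs X. D (vscale X r x) = vscale Y r (D x))"

text \<open>
  Extended values: an unbounded map has norm \<open>\<infinity>\<close>, and the distance of non-isomorphic spaces is
  \<open>\<infinity>\<close> (the infimum of the empty set).
\<close>

definition operator_norm :: "'v snspace \<Rightarrow> 'u snspace \<Rightarrow> ('v \<Rightarrow> 'u) \<Rightarrow> ennreal" where
  "operator_norm X Y D = (SUP x \<in> {x \<in> vecs X. vnorm X x \<le> 1}. ennreal (vnorm Y (D x)))"

definition banach_mazur :: "'v snspace \<Rightarrow> 'u snspace \<Rightarrow> ennreal" where
  "banach_mazur X Y =
     (INF D \<in> {D. linear_iso X Y D}.
        operator_norm X Y D * operator_norm Y X (inv_into (vecs X) D))"


section \<open>The spaces of the statement\<close>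

text \<open>\<open>\<real>\<^sup>n\<close> is the set of functions vanishing outside \<open>{..<n}\<close>; the inserted \<open>0\<close> only
  matters for \<open>n = 0\<close>.\<close>

definition linf :: "nat \<Rightarrow> (nat \<Rightarrow> real) snspace" where
  "linf n = function_space {a. \<forall>i\<ge>n. a i = 0} (\<lambda>a. Max (insert 0 ((\<lambda>i. \<bar>a i\<bar>) ` {..<n})))"

text \<open>Functions on \<open>M\<close> are functions on the type that vanish outside \<open>M\<close>.\<close>

definition TP :: "'a set \<Rightarrow> ('a \<Rightarrow> real) set" where
  "TP M = {f. finite {x. f x \<noteq> 0} \<and> {x. f x \<noteq> 0} \<subseteq> M \<and> (\<Sum>x | f x \<noteq> 0. f x) = 0}"

text \<open>
  For a nonempty metric space the supremum is over a bounded set: as \<open>f\<close> has total mass \<open>0\<close>,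
  each term is at most \<open>\<Sum>x. d x\<^sub>0 x * \<bar>f x\<bar>\<close>, for any fixed point \<open>x\<^sub>0\<close> of \<open>M\<close>.
\<close>

definition dp_norm :: "'a set \<Rightarrow> ('a \<Rightarrow> 'a \<Rightarrow> real) \<Rightarrow> ('a \<Rightarrow> real) \<Rightarrow> real" where
  "dp_norm M d f =
     (SUP (u, v) \<in> M \<times> M. \<bar>\<Sum>x | f x \<noteq> 0. (d v x - d u x) / 2 * f x\<bar>)"

definition TP_DP :: "'a set \<Rightarrow> ('a \<Rightarrow> 'a \<Rightarrow> real) \<Rightarrow> (nat \<Rightarrow> ('a \<Rightarrow> real) set) set snspace" where
  "TP_DP M d = completion (kernel_quotient (function_space (TP M) (dp_norm M d)))"


section \<open>Weighted finite trees\<close>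

definition finite_graph :: "'a set \<Rightarrow> 'a set set \<Rightarrow> bool" where
  "finite_graph V E \<longleftrightarrow> finite V \<and> (\<forall>e\<in>E. \<exists>u\<in>V. \<exists>v\<in>V. u \<noteq> v \<and> e = {u, v})"

definition path_between :: "'a set \<Rightarrow> 'a set set \<Rightarrow> 'a \<Rightarrow> 'a \<Rightarrow> 'a list \<Rightarrow> bool" where
  "path_between V E x y p \<longleftrightarrow> p \<noteq> [] \<and> hd p = x \<and> last p = y \<and> distinct p \<and> set p \<subseteq> V \<and>
     successively (\<lambda>u v. {u, v} \<in> E) p"

definition cycle_in :: "'a set set \<Rightarrow> 'a list \<Rightarrow> bool" where
  "cycle_in E p \<longleftrightarrow> length p \<ge> 3 \<and> distinct p \<and> successively (\<lambda>u v. {u, v} \<in> E) p \<and>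
     {last p, hd p} \<in> E"

definition finite_tree :: "'a set \<Rightarrow> 'a set set \<Rightarrow> bool" where
  "finite_tree V E \<longleftrightarrow> finite_graph V E \<and> V \<noteq> {} \<and>
     (\<forall>x\<in>V. \<forall>y\<in>V. \<exists>p. path_between V E x y p) \<and> (\<nexists>p. cycle_in E p)"

definition path_weight :: "('a set \<Rightarrow> real) \<Rightarrow> 'a list \<Rightarrow> real" where
  "path_weight w p = (\<Sum>i<length p - 1. w {p ! i, p ! Suc i})"

definition tree_dist :: "'a set \<Rightarrow> 'a set set \<Rightarrow> ('a set \<Rightarrow> real) \<Rightarrow> 'a \<Rightarrow> 'a \<Rightarrow> real" where
  "tree_dist V E w x y = path_weight w (THE p. path_between V E x y p)"

end

theory Submission
  imports Defs
begin

text \<open>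
  The potential \<open>g v = (\<Sum>x. d v x * f x) / 2\<close> of \<open>f\<close> turns \<open>\<parallel>f\<parallel>\<close> into the oscillation
  \<open>max g - min g\<close>. On a tree, \<open>f \<mapsto> g\<close> is a bijection from \<open>TP V\<close> onto the functions on \<open>V\<close> modulo
  constants, by induction on pendant edges. Normalising \<open>g\<close> to vanish at a root leaves
  \<open>card V - 1 = card E\<close> free values, and the oscillation of such a \<open>g\<close> lies between \<open>max \<bar>g\<bar>\<close> and
  \<open>2 * max \<bar>g\<bar>\<close>. So the distance is even at most \<open>2\<close>.
\<close>

section \<open>Trees and pendant edges\<close>

text \<open>Attaching a leaf \<open>l\<close> to \<open>p\<close> changes potentials in a controlled
  way. Because the total mass is 0, moving the mass \<open>f l\<close> to \<open>p\<close> changes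
  the (unhalved) potential on the old vertices only by a constant, and the jump of the potential
  from \<open>l\<close> to \<open>p\<close> equals \<open>2 * w {l, p} * f l\<close>. So the mass at
  a leaf can be read off from one jump, and prescribed by it, since positive weights allow the
  division; this yields injectivity and surjectivity alike. The rest of the work is forced by the
  carrier, whose elements are classes of Cauchy sequences of kernel cosets. Injectivity modulo
  constants makes the seminorm a norm, and surjectivity on a finite vertex set makes it complete, so
  quotient and completion return the original space up to a linear isometry. The estimate can then
  be made on \<open>TP V\<close> itself.\<close>

lemma path_between_rev:
  "path_between V E x y (rev q) \<longleftrightarrow> path_between V E y x q"
  by (auto simp: path_between_def hd_rev last_rev successively_rev insert_commute)

context
  fixes V :: "'a set" and E :: "'a set set" and l p :: 'a
  assumes graph: "finite_graph V E" and l: "l \<notin> V" and p: "p \<in> V"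
begin

lemma edge_avoids_new: "e \<in> E \<Longrightarrow> l \<notin> e"
  using graph l by (auto simp: finite_graph_def)

lemma new_edge_iff: "{l, v} \<in> insert {l, p} E \<longleftrightarrow> v = p"
  using edge_avoids_new by (auto simp: doubleton_eq_iff)

lemma successively_avoiding_new:
  assumes "l \<notin> set q"
  shows "successively (\<lambda>u v. {u, v} \<in> insert {l, p} E) q \<longleftrightarrow> successively (\<lambda>u v. {u, v} \<in> E) q"
  using assms by (intro successively_cong) (auto simp: doubleton_eq_iff)

text \<open>The ends lie in \<open>V\<close>, so \<open>l\<close> could only be an inner vertex.
  Both its neighbours on the path would then be \<open>p\<close>, its only neighbour, against
  distinctness.\<close>

lemma path_avoids_new:
  assumes "path_between (insert l V) (insert {l, p} E) x y q" and "x \<in> V" "y \<in> V"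
  shows "l \<notin> set q"
proof
  assume "l \<in> set q"
  then obtain r s where q: "q = r @ l # s"
    by (meson split_list)
  have "r \<noteq> []" "s \<noteq> []"
    using assms l by (auto simp: path_between_def q)
  then have "{last r, l} \<in> insert {l, p} E" and hd: "{l, hd s} \<in> insert {l, p} E"
    using assms by (auto simp: path_between_def q successively_append_iff successively_Cons)
  then have "{l, last r} \<in> insert {l, p} E"
    by (simp only: doubleton_eq_iff insert_commute[of "last r" l "{}"])
  with hd have "last r = p" "hd s = p"
    unfolding new_edge_iff by blast+
  then have "p \<in> set r" "p \<in> set s"
    using last_in_set[OF \<open>r \<noteq> []\<close>] hd_in_set[OF \<open>s \<noteq> []\<close>] by simp_all
  then show False
    using assms by (auto simp: path_between_def q)
qed

lemma path_old_old:
  assumes "x \<in> V" "y \<in> V"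
  shows "path_between (insert l V) (insert {l, p} E) x y q \<longleftrightarrow> path_between V E x y q"
proof
  assume *: "path_between (insert l V) (insert {l, p} E) x y q"
  show "path_between V E x y q"
    using * path_avoids_new[OF * assms] successively_avoiding_new
    by (auto simp: path_between_def)
next
  assume *: "path_between V E x y q"
  then have "l \<notin> set q" using l by (auto simp: path_between_def)
  with * show "path_between (insert l V) (insert {l, p} E) x y q"
    using successively_avoiding_new by (auto simp: path_between_def)
qed

lemma path_new_old:
  assumes "y \<in> V"
  shows "path_between (insert l V) (insert {l, p} E) l y q \<longleftrightarrow>
    (\<exists>r. q = l # r \<and> path_between V E p y r)"
proof
  assume *: "path_between (insert l V) (insert {l, p} E) l y q"
  then obtain r where q: "q = l # r"
    by (cases q) (auto simp: path_between_def)
  have "r \<noteq> []"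
    using * assms l by (auto simp: path_between_def q)
  then have "{l, hd r} \<in> insert {l, p} E"
    using * by (auto simp: path_between_def q successively_Cons)
  then have "hd r = p" by (simp only: new_edge_iff)
  then have "path_between (insert l V) (insert {l, p} E) p y r"
    using * \<open>r \<noteq> []\<close> by (auto simp: path_between_def q successively_Cons)
  then show "\<exists>r. q = l # r \<and> path_between V E p y r"
    using path_old_old[OF p assms] q by auto
next
  assume "\<exists>r. q = l # r \<and> path_between V E p y r"
  then obtain r where q: "q = l # r" and r: "path_between V E p y r" by auto
  have "l \<notin> set r" using r l by (auto simp: path_between_def)
  moreover have "path_between (insert l V) (insert {l, p} E) p y r"
    using path_old_old[OF p assms] r by auto
  ultimately show "path_between (insert l V) (insert {l, p} E) l y q"
    by (auto simp: path_between_def q successively_Cons)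
qed

text \<open>The mirror image of \<open>path_new_old\<close>, obtained by reversing paths.\<close>

lemma path_old_new:
  assumes "x \<in> V"
  shows "path_between (insert l V) (insert {l, p} E) x l q \<longleftrightarrow>
    (\<exists>r. q = r @ [l] \<and> path_between V E x p r)"
proof -
  have "path_between (insert l V) (insert {l, p} E) x l q \<longleftrightarrow>
      (\<exists>r. rev q = l # r \<and> path_between V E p x r)"
    using path_new_old[OF assms, of "rev q"] by (simp add: path_between_rev)
  also have "\<dots> \<longleftrightarrow> (\<exists>r. q = rev r @ [l] \<and> path_between V E x p (rev r))"
    by (metis path_between_rev rev.simps(2) rev_rev_ident)
  also have "\<dots> \<longleftrightarrow> (\<exists>r. q = r @ [l] \<and> path_between V E x p r)"
    by (metis rev_rev_ident)
  finally show ?thesis .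
qed

end

section \<open>Leaves, induction over trees and uniqueness of paths\<close>

lemma path_loop: "x \<in> V \<Longrightarrow> path_between V E x x q \<longleftrightarrow> q = [x]"
  by (cases q) (auto simp: path_between_def split: if_splits)

text \<open>The first vertex of a longest path is a leaf: a neighbour other than the second vertex
  would either extend the path or, lying further along it, close a cycle.\<close>

lemma tree_has_leaf:
  assumes tree: "finite_tree V E" and nontrivial: "x \<in> V" "y \<in> V" "x \<noteq> y"
  obtains l p where "l \<in> V" "p \<in> V" "l \<noteq> p" "{l, p} \<in> E" "\<And>e. e \<in> E \<Longrightarrow> l \<in> e \<Longrightarrow> e = {l, p}"
proof -
  define P where "P q \<longleftrightarrow> distinct q \<and> set q \<subseteq> V \<and> successively (\<lambda>u v. {u, v} \<in> E) q" for q
  have graph: "finite_graph V E" and finV: "finite V" and acyclic: "\<not> cycle_in E q" for q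
    using tree by (auto simp: finite_tree_def finite_graph_def)
  obtain q0 where q0: "path_between V E x y q0"
    using tree nontrivial unfolding finite_tree_def by blast
  have "P q0" using q0 by (auto simp: P_def path_between_def)
  \<comment> \<open>Two distinct vertices give a path with two entries, so a longest path has a
    second vertex to serve as \<open>p\<close>.\<close>
  have len0: "length q0 \<ge> 2"
    using q0 nontrivial by (cases q0; cases "tl q0") (auto simp: path_between_def)
  have "\<forall>q. P q \<longrightarrow> length q < Suc (card V)"
    using finV by (auto simp: P_def less_Suc_eq_le distinct_card[symmetric] card_mono)
  then obtain q where q: "P q" and longest: "\<And>r. P r \<Longrightarrow> length r \<le> length q"
    using ex_has_greatest_nat[of P q0 length] \<open>P q0\<close> by blast
  obtain l p r where lpr: "q = l # p # r"
    using len0 longest[OF \<open>P q0\<close>] by (cases q; cases "tl q") auto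
  have "e = {l, p}" if "e \<in> E" "l \<in> e" for e
  proof -
    obtain a b where "a \<in> V" "b \<in> V" "a \<noteq> b" "e = {a, b}"
      using graph \<open>e \<in> E\<close> unfolding finite_graph_def by blast
    then obtain u where u: "u \<in> V" "u \<noteq> l" "e = {l, u}"
      using \<open>l \<in> e\<close> by (metis insertE insert_commute singletonD)
    have "u \<in> set q"
    proof (rule ccontr)
      assume "u \<notin> set q"
      then have "P (u # q)"
        using q u that by (auto simp: P_def lpr insert_commute)
      from longest[OF this] show False by simp
    qed
    \<comment> \<open>Otherwise the part of \<open>q\<close> from \<open>l\<close> up to
      \<open>u\<close>, closed by the edge \<open>e\<close>, is a cycle; it contains
      \<open>l\<close>, \<open>p\<close> and \<open>u\<close>, hence has length at least 3.\<close>
    moreover have "u \<notin> set r"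
    proof
      assume "u \<in> set r"
      then obtain r1 r2 where r: "r = r1 @ u # r2" by (meson split_list)
      have "cycle_in E (l # p # r1 @ [u])"
        using q u that
        by (auto simp: cycle_in_def P_def lpr r successively_Cons successively_append_iff insert_commute
            hd_append split: if_splits)
      with acyclic show False by blast
    qed
    ultimately show ?thesis using u lpr by auto
  qed
  moreover have "l \<in> V" "p \<in> V" "l \<noteq> p" "{l, p} \<in> E"
    using q by (auto simp: P_def lpr)
  ultimately show thesis using that by blast
qed

text \<open>Deleting a leaf leaves a tree: paths between the other vertices never visit it, and
  fewer edges create no cycle. The pendant case also receives that the larger graph is a tree, so
  that uniqueness of paths can be invoked in it.\<close>

lemma finite_tree_induct [consumes 1, case_names singleton pendant]:
  assumes "finite_tree V E"
    and singleton: "\<And>v. P {v} {}"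
    and pendant: "\<And>V E l p. finite_tree V E \<Longrightarrow> l \<notin> V \<Longrightarrow> p \<in> V \<Longrightarrow>
      finite_tree (insert l V) (insert {l, p} E) \<Longrightarrow> P V E \<Longrightarrow> P (insert l V) (insert {l, p} E)"
  shows "P V E"
  using assms(1)
proof (induction "card V" arbitrary: V E rule: less_induct)
  case less
  have graph: "finite_graph V E" and "V \<noteq> {}" and finV: "finite V"
    using less.prems by (auto simp: finite_tree_def finite_graph_def)
  then obtain v where v: "v \<in> V" by auto
  show ?case
  proof (cases "V = {v}")
    case True
    then have "E = {}" using graph by (auto simp: finite_graph_def)
    with True singleton show ?thesis by simp
  next
    case False
    then obtain v' where "v' \<in> V" "v \<noteq> v'" using v by auto
    then obtain l p where lp: "l \<in> V" "p \<in> V" "l \<noteq> p" "{l, p} \<in> E"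
      and leaf: "\<And>e. e \<in> E \<Longrightarrow> l \<in> e \<Longrightarrow> e = {l, p}"
      using tree_has_leaf[OF less.prems v] by metis
    define V0 where "V0 = V - {l}"
    define E0 where "E0 = E - {{l, p}}"
    have V: "V = insert l V0" and E: "E = insert {l, p} E0" and l0: "l \<notin> V0" and p0: "p \<in> V0"
      using lp by (auto simp: V0_def E0_def)
    have graph0: "finite_graph V0 E0"
      unfolding finite_graph_def
    proof (intro conjI ballI)
      show "finite V0" using finV by (simp add: V0_def)
      fix e assume e: "e \<in> E0"
      then obtain a b where "a \<in> V" "b \<in> V" "a \<noteq> b" "e = {a, b}"
        using graph e unfolding finite_graph_def E0_def by blast
      moreover have "l \<notin> e" using leaf[of e] e by (auto simp: E0_def)
      ultimately show "\<exists>u\<in>V0. \<exists>v\<in>V0. u \<noteq> v \<and> e = {u, v}"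
        by (auto simp: V0_def)
    qed
    have "finite_tree V0 E0"
      unfolding finite_tree_def
    proof (intro conjI ballI)
      show "V0 \<noteq> {}" using p0 by auto
      show "\<nexists>q. cycle_in E0 q"
      proof
        assume "\<exists>q. cycle_in E0 q"
        then obtain q where q: "cycle_in E0 q" by blast
        then have "cycle_in E q"
          using successively_mono[of "\<lambda>u v. {u, v} \<in> E0" q "\<lambda>u v. {u, v} \<in> E"]
          by (simp add: cycle_in_def E0_def)
        then show False using less.prems by (auto simp: finite_tree_def)
      qed
      fix x y assume xy: "x \<in> V0" "y \<in> V0"
      then obtain q where "path_between V E x y q"
        using less.prems unfolding finite_tree_def V0_def by blast
      then show "\<exists>q. path_between V0 E0 x y q"
        using path_old_old[OF graph0 l0 p0 xy] V E by auto
    qed (rule graph0)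
    moreover have "card V0 < card V" unfolding V0_def by (rule card_Diff1_less[OF finV lp(1)])
    ultimately show ?thesis
      using pendant less.hyps less.prems l0 p0 unfolding V E by metis
  qed
qed

text \<open>Gives meaning to the definite description in \<open>tree_dist\<close>. A path touching
  the new leaf is determined by its remainder in the smaller tree, which runs to or from
  \<open>p\<close>.\<close>

lemma tree_ex1_path:
  assumes "finite_tree V E" "x \<in> V" "y \<in> V"
  shows "\<exists>!q. path_between V E x y q"
  using assms
proof (induction arbitrary: x y rule: finite_tree_induct)
  case (singleton v)
  then show ?case by (simp add: path_loop)
next
  case (pendant V E l p)
  have graph: "finite_graph V E" using pendant by (simp add: finite_tree_def)
  note * = path_old_old[OF graph \<open>l \<notin> V\<close> \<open>p \<in> V\<close>] path_new_old[OF graph \<open>l \<notin> V\<close> \<open>p \<in> V\<close>]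
    path_old_new[OF graph \<open>l \<notin> V\<close> \<open>p \<in> V\<close>]
  consider "x \<in> V" "y \<in> V" | "x = l" "y \<in> V" | "x \<in> V" "y = l" | "x = l" "y = l"
    using pendant.prems by auto
  then show ?case
  proof cases
    case 1 then show ?thesis using pendant.IH by (simp add: *)
  next
    case 2 then show ?thesis using pendant.IH[OF \<open>p \<in> V\<close> 2(2)] by (simp add: *) blast
  next
    case 3 then show ?thesis using pendant.IH[OF 3(1) \<open>p \<in> V\<close>] by (simp add: *) blast
  next
    case 4 then show ?thesis by (simp add: path_loop)
  qed
qed

section \<open>Tree distances and the number of edges\<close>

lemma tree_dist_eq:
  assumes "finite_tree V E" "x \<in> V" "y \<in> V" "path_between V E x y q"
  shows "tree_dist V E w x y = path_weight w q"
  using the1_equality[OF tree_ex1_path[OF assms(1-3)] assms(4)] by (simp add: tree_dist_def)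

lemma tree_dist_self: "x \<in> V \<Longrightarrow> tree_dist V E w x x = 0"
  by (simp add: tree_dist_def path_loop path_weight_def)

lemma path_weight_Cons:
  assumes "q \<noteq> []"
  shows "path_weight w (x # q) = w {x, hd q} + path_weight w q"
proof -
  \<comment> \<open>Writing the length as a successor removes the truncated subtraction from the
    index range of \<open>path_weight\<close>.\<close>
  obtain n where n: "length q = Suc n" using assms by (cases q) auto
  show ?thesis
    using assms by (simp add: path_weight_def n sum.lessThan_Suc_shift hd_conv_nth del: sum.lessThan_Suc)
qed

lemma path_weight_snoc:
  assumes "q \<noteq> []"
  shows "path_weight w (q @ [x]) = path_weight w q + w {last q, x}"
proof -
  obtain n where n: "length q = Suc n" using assms by (cases q) auto
  show ?thesis
    using assms by (simp add: path_weight_def n nth_append last_conv_nth)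
qed

text \<open>Every path from or to \<open>l\<close> runs through \<open>p\<close>. Both orders are
  recorded: the potential at \<open>l\<close> uses distances from \<open>l\<close>, the potential at
  an old vertex uses its distance to \<open>l\<close>.\<close>

lemma tree_dist_pendant:
  assumes tree: "finite_tree V E" and tree': "finite_tree (insert l V) (insert {l, p} E)"
    and l: "l \<notin> V" and p: "p \<in> V" and x: "x \<in> V"
  shows "y \<in> V \<Longrightarrow> tree_dist (insert l V) (insert {l, p} E) w x y = tree_dist V E w x y"
    and "tree_dist (insert l V) (insert {l, p} E) w l x = w {l, p} + tree_dist V E w p x"
    and "tree_dist (insert l V) (insert {l, p} E) w x l = tree_dist V E w x p + w {l, p}"
proof -
  have graph: "finite_graph V E" using tree by (simp add: finite_tree_def)
  show "tree_dist (insert l V) (insert {l, p} E) w x y = tree_dist V E w x y" if "y \<in> V"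
    using path_old_old[OF graph l p x that] by (simp add: tree_dist_def)
  obtain q where q: "path_between V E p x q" "q \<noteq> []" "hd q = p"
    using tree_ex1_path[OF tree p x] by (auto simp: path_between_def)
  have "path_between (insert l V) (insert {l, p} E) l x (l # q)"
    using path_new_old[OF graph l p x] q by blast
  from tree_dist_eq[OF tree' _ _ this] tree_dist_eq[OF tree p x q(1)]
  show "tree_dist (insert l V) (insert {l, p} E) w l x = w {l, p} + tree_dist V E w p x"
    using x q by (simp add: path_weight_Cons)
  obtain q where q: "path_between V E x p q" "q \<noteq> []" "last q = p"
    using tree_ex1_path[OF tree x p] by (auto simp: path_between_def)
  have "path_between (insert l V) (insert {l, p} E) x l (q @ [l])"
    using path_old_new[OF graph l p x] q by blast
  from tree_dist_eq[OF tree' _ _ this] tree_dist_eq[OF tree x p q(1)]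
  show "tree_dist (insert l V) (insert {l, p} E) w x l = tree_dist V E w x p + w {l, p}"
    using x q by (simp add: path_weight_snoc insert_commute)
qed

lemma finite_tree_finite: "finite_tree V E \<Longrightarrow> finite V"
  by (simp add: finite_tree_def finite_graph_def)

lemma finite_tree_finite_edges: "finite_tree V E \<Longrightarrow> finite E"
  by (rule finite_subset[of E "Pow V"]) (auto simp: finite_tree_def finite_graph_def)

lemma card_tree: "finite_tree V E \<Longrightarrow> card V = Suc (card E)"
proof (induction rule: finite_tree_induct)
  case (pendant V E l p)
  have "{l, p} \<notin> E"
    using edge_avoids_new[of V E l p "{l, p}"] pendant by (auto simp: finite_tree_def)
  with pendant show ?case by (simp add: finite_tree_finite finite_tree_finite_edges)
qed simp


section \<open>Potentials\<close>

text \<open>The factor 1/2 of the double-point norm is left out here, which is why bounds on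
  differences of potentials carry a factor 2 below.\<close>

definition potential :: "'a set \<Rightarrow> ('a \<Rightarrow> 'a \<Rightarrow> real) \<Rightarrow> ('a \<Rightarrow> real) \<Rightarrow> 'a \<Rightarrow> real" where
  "potential V d f v = (\<Sum>x\<in>V. d v x * f x)"

text \<open>Collapsing the pendant edge moves the mass at \<open>l\<close> to \<open>p\<close>.\<close>

lemma potential_pendant:
  fixes w :: "'a set \<Rightarrow> real"
  assumes tree: "finite_tree V E" and tree': "finite_tree (insert l V) (insert {l, p} E)"
    and l: "l \<notin> V" and p: "p \<in> V"
    and sum0: "sum f V + f l = 0"
  defines "g \<equiv> potential V (tree_dist V E w) (f(p := f p + f l))"
    and "g' \<equiv> potential (insert l V) (tree_dist (insert l V) (insert {l, p} E) w) f"
  shows "sum (f(p := f p + f l)) V = 0"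
    and "v \<in> V \<Longrightarrow> g' v = g v + w {l, p} * f l"
    and "g' l = g p - w {l, p} * f l"
proof -
  have fin: "finite V" using tree by (rule finite_tree_finite)
  note d = tree_dist_pendant[OF tree tree' l p]
  \<comment> \<open>Stated for arbitrary coefficients: \<open>c = 1\<close> gives the total mass, a
    row of distances gives the potential.\<close>
  have upd: "(\<Sum>x\<in>V. c x * (f(p := f p + f l)) x) = (\<Sum>x\<in>V. c x * f x) + c p * f l" for c
    using fin p by (simp add: sum.remove[of V p] algebra_simps)
  show "sum (f(p := f p + f l)) V = 0"
    using upd[of "\<lambda>_. 1"] sum0 by simp
  show "g' v = g v + w {l, p} * f l" if "v \<in> V"
    using fin l that upd[of "tree_dist V E w v"]
    by (simp add: g_def g'_def potential_def d algebra_simps)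
  have "g' l = (\<Sum>x\<in>V. (w {l, p} + tree_dist V E w p x) * f x)"
    using fin l by (simp add: g'_def potential_def d tree_dist_self)
  also have "\<dots> = w {l, p} * sum f V + (\<Sum>x\<in>V. tree_dist V E w p x * f x)"
    by (simp add: distrib_right sum.distrib sum_distrib_left)
  \<comment> \<open>Seen from \<open>l\<close>, all old vertices are farther by
    \<open>w {l, p}\<close> than seen from \<open>p\<close>; as their total mass is
    \<open>- f l\<close>, this contributes \<open>- w {l, p} * f l\<close>. The mass moved to
    \<open>p\<close> adds nothing to the potential at \<open>p\<close> itself.\<close>
  also have "sum f V = - f l" using sum0 by simp
  finally show "g' l = g p - w {l, p} * f l"
    using upd[of "tree_dist V E w p"] p by (simp add: g_def potential_def tree_dist_self)
qed

text \<open>A constant potential has no jump across the pendant edge, so \<open>f l = 0\<close>.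
  Collapsing then leaves \<open>f\<close> and its potential on \<open>V\<close> unchanged, and the
  induction hypothesis applies with the same constant.\<close>

lemma tree_potential_inj:
  assumes "finite_tree V E" and "\<And>e. e \<in> E \<Longrightarrow> w e > 0"
    and "sum f V = 0" and "\<And>v. v \<in> V \<Longrightarrow> potential V (tree_dist V E w) f v = c"
    and "x \<in> V"
  shows "f x = 0"
  using assms
proof (induction arbitrary: f c x rule: finite_tree_induct)
  case (pendant V E l p)
  have sum0: "sum f V + f l = 0"
    using pendant by (simp add: finite_tree_finite)
  note pot = potential_pendant[OF \<open>finite_tree V E\<close> pendant.hyps(4,2,3) sum0]
  let ?f = "f(p := f p + f l)"
  have "w {l, p} * f l = - (w {l, p} * f l)"
    using pot(2)[OF \<open>p \<in> V\<close>, where w = w] pot(3)[where w = w] pendant.prems(3)[of l]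
      pendant.prems(3)[of p] \<open>p \<in> V\<close> by simp
  with pendant.prems(1)[of "{l, p}"] have fl: "f l = 0" by simp
  have "f x = 0" if "x \<in> V" for x
  proof (rule pendant.IH[OF _ _ _ that])
    show "sum f V = 0" using sum0 fl by simp
    show "potential V (tree_dist V E w) f v = c" if "v \<in> V" for v
      using pot(2)[OF that, where w = w] pendant.prems(3)[of v] that fl by simp
  qed (use pendant.prems in auto)
  with fl pendant.prems show ?case by auto
qed simp

text \<open>The free constant \<open>c\<close> compensates for the condition that the total mass is
  0, and it absorbs the shift produced by each new leaf.\<close>

lemma tree_potential_surj:
  assumes "finite_tree V E" and "\<And>e. e \<in> E \<Longrightarrow> w e > 0"
  shows "\<exists>f c. sum f V = 0 \<and> (\<forall>v\<in>V. potential V (tree_dist V E w) f v = h v + c)"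
  using assms
proof (induction rule: finite_tree_induct)
  case (singleton v)
  show ?case
    by (rule exI[of _ "\<lambda>_. 0"], rule exI[of _ "- h v"]) (simp add: potential_def)
next
  case (pendant V E l p)
  then obtain f c where f: "sum f V = 0" "\<And>v. v \<in> V \<Longrightarrow> potential V (tree_dist V E w) f v = h v + c"
    by auto
  have w: "w {l, p} > 0" using pendant.prems by simp
  \<comment> \<open>The jump of the potential from \<open>l\<close> to \<open>p\<close> will be
    \<open>2 * w {l, p} * a\<close>, and it has to equal \<open>h p - h l\<close>.\<close>
  define a where "a = (h p - h l) / (2 * w {l, p})"
  \<comment> \<open>The mass placed at \<open>l\<close> is taken from \<open>p\<close>, so
    collapsing the edge gives back \<open>f\<close> on \<open>V\<close>.\<close>
  define f' where "f' = f(p := f p - a, l := a)"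
  have "l \<noteq> p" using pendant by auto
  have fin: "finite V" using pendant.hyps(1) by (rule finite_tree_finite)
  have "sum f' V = sum (f(p := f p - a)) V"
    using pendant.hyps by (intro sum.cong) (auto simp: f'_def)
  also have "\<dots> = sum f V - a"
    using fin pendant.hyps by (simp add: sum.remove[of V p])
  finally have sum0: "sum f' V + f' l = 0"
    using f by (simp add: f'_def)
  note pot = potential_pendant[OF \<open>finite_tree V E\<close> pendant.hyps(4,2,3) sum0]
  have eq: "potential V (tree_dist V E w) (f'(p := f' p + f' l)) v = h v + c" if "v \<in> V" for v
    unfolding f(2)[OF that, symmetric] potential_def
    using \<open>l \<notin> V\<close> by (intro sum.cong) (auto simp: f'_def)
  show ?case
  proof (intro exI[of _ f'] exI[of _ "c + w {l, p} * a"] conjI ballI)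
    show "sum f' (insert l V) = 0"
      using sum0 fin \<open>l \<notin> V\<close> by simp
    have fl: "f' l = a" by (simp add: f'_def)
    have a: "2 * (w {l, p} * a) = h p - h l" using w by (simp add: a_def)
    fix v assume "v \<in> insert l V"
    then consider "v \<in> V" | "v = l" by blast
    then show "potential (insert l V) (tree_dist (insert l V) (insert {l, p} E) w) f' v =
        h v + (c + w {l, p} * a)"
    proof cases
      case 1
      with pot(2)[OF this, where w = w] eq[OF this] fl show ?thesis by simp
    next
      case 2
      from pot(3)[where w = w] eq[OF \<open>p \<in> V\<close>] a show ?thesis
        unfolding 2 fl by linarith
    qed
  qed
qed


lemma potential_add: "potential V d (\<lambda>x. f x + g x) v = potential V d f v + potential V d g v"
  by (simp add: potential_def sum.distrib distrib_left)

lemma potential_scale: "potential V d (\<lambda>x. r * f x) v = r * potential V d f v"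
  by (simp add: potential_def sum_distrib_left mult_ac)

section \<open>The double-point norm in terms of potentials\<close>

lemma TP_iff:
  assumes "finite V"
  shows "f \<in> TP V \<longleftrightarrow> (\<forall>x. x \<notin> V \<longrightarrow> f x = 0) \<and> sum f V = 0"
proof -
  have "(\<Sum>x | f x \<noteq> 0. f x) = sum f V" if "{x. f x \<noteq> 0} \<subseteq> V"
    using assms that by (intro sum.mono_neutral_left) auto
  moreover have "(\<forall>x. x \<notin> V \<longrightarrow> f x = 0) \<longleftrightarrow> {x. f x \<noteq> 0} \<subseteq> V" by auto
  ultimately show ?thesis
    using finite_subset[OF _ assms, of "{x. f x \<noteq> 0}"] unfolding TP_def by auto
qed

lemma dp_norm_alt:
  assumes "finite V" "f \<in> TP V"
  shows "dp_norm V d f = (SUP (u, v) \<in> V \<times> V. \<bar>potential V d f v - potential V d f u\<bar> / 2)"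
proof -
  have "(\<Sum>x | f x \<noteq> 0. (d v x - d u x) / 2 * f x) = (potential V d f v - potential V d f u) / 2" for u v
  proof -
    have "(\<Sum>x | f x \<noteq> 0. (d v x - d u x) / 2 * f x) = (\<Sum>x\<in>V. (d v x - d u x) / 2 * f x)"
      using assms by (intro sum.mono_neutral_left) (auto simp: TP_def)
    then show ?thesis
      by (simp add: potential_def sum_subtractf[symmetric] sum_divide_distrib algebra_simps diff_divide_distrib)
  qed
  then show ?thesis unfolding dp_norm_def by (simp only: abs_divide abs_numeral)
qed

text \<open>Together with \<open>dp_norm_ge\<close> this replaces the supremum in all later
  arguments.\<close>

lemma dp_norm_le:
  assumes "finite V" "V \<noteq> {}" "f \<in> TP V"
    and "\<And>u v. u \<in> V \<Longrightarrow> v \<in> V \<Longrightarrow> \<bar>potential V d f v - potential V d f u\<bar> \<le> 2 * B"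
  shows "dp_norm V d f \<le> B"
  unfolding dp_norm_alt[OF assms(1,3)] using assms by (intro cSUP_least) fastforce+

lemma dp_norm_ge:
  assumes "finite V" "f \<in> TP V" "u \<in> V" "v \<in> V"
  shows "\<bar>potential V d f v - potential V d f u\<bar> \<le> 2 * dp_norm V d f"
proof -
  have "(\<lambda>(u, v). \<bar>potential V d f v - potential V d f u\<bar> / 2) (u, v) \<le> dp_norm V d f"
    unfolding dp_norm_alt[OF assms(1,2)] using assms
    by (intro cSUP_upper bdd_above_finite finite_imageI finite_cartesian_product) auto
  then show ?thesis by simp
qed


section \<open>Completions of complete spaces\<close>

definition isometric_iso :: "'v snspace \<Rightarrow> 'u snspace \<Rightarrow> ('v \<Rightarrow> 'u) \<Rightarrow> bool" where
  "isometric_iso X Y J \<longleftrightarrow> linear_iso X Y J \<and> (\<forall>x\<in>vecs X. vnorm Y (J x) = vnorm X x)"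

lemma linear_iso_comp:
  "linear_iso X Y D \<Longrightarrow> linear_iso Y Z D' \<Longrightarrow> linear_iso X Z (D' \<circ> D)"
  unfolding linear_iso_def using bij_betw_trans by (auto simp: bij_betw_apply)

lemma isometric_iso_comp:
  "isometric_iso X Y D \<Longrightarrow> isometric_iso Y Z D' \<Longrightarrow> isometric_iso X Z (D' \<circ> D)"
  using linear_iso_comp[of X Y D Z D'] by (auto simp: isometric_iso_def linear_iso_def bij_betw_apply)

text \<open>The first estimate bounds \<open>D\<close>; the second, read at the preimage of a vector
  of the target, bounds the inverse.\<close>

lemma banach_mazur_le:
  assumes "linear_iso X Y D"
    and "\<And>x. x \<in> vecs X \<Longrightarrow> vnorm Y (D x) \<le> a * vnorm X x"
    and "\<And>x. x \<in> vecs X \<Longrightarrow> vnorm X x \<le> b * vnorm Y (D x)"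
    and "0 \<le> a" "0 \<le> b"
  shows "banach_mazur X Y \<le> ennreal (a * b)"
proof -
  have "operator_norm X Y D \<le> ennreal a"
    unfolding operator_norm_def
  proof (rule SUP_least, rule ennreal_leI)
    fix x assume "x \<in> {x \<in> vecs X. vnorm X x \<le> 1}"
    then show "vnorm Y (D x) \<le> a"
      using assms(2)[of x] mult_left_mono[of "vnorm X x" 1 a] \<open>0 \<le> a\<close> by auto
  qed
  moreover have "operator_norm Y X (inv_into (vecs X) D) \<le> ennreal b"
    unfolding operator_norm_def
  proof (rule SUP_least, rule ennreal_leI)
    fix y assume y: "y \<in> {y \<in> vecs Y. vnorm Y y \<le> 1}"
    then have "y \<in> D ` vecs X"
      using assms(1) by (auto simp: linear_iso_def bij_betw_def)
    then show "vnorm X (inv_into (vecs X) D y) \<le> b"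
      using y assms(3)[of "inv_into (vecs X) D y"] mult_left_mono[of "vnorm Y y" 1 b] \<open>0 \<le> b\<close>
      by (auto simp: inv_into_into f_inv_into_f)
  qed
  ultimately have "operator_norm X Y D * operator_norm Y X (inv_into (vecs X) D) \<le> ennreal a * ennreal b"
    by (rule mult_mono) auto
  then show ?thesis
    unfolding banach_mazur_def using assms
    by (intro INF_lower2[of D]) (auto simp: ennreal_mult)
qed

text \<open>The laws are chosen for passing to classes: \<open>dist_eq_0\<close> makes kernel cosets
  singletons, \<open>dist_add\<close>, \<open>dist_scale\<close> and \<open>norm_diff\<close> make
  the operations and the norm independent of representatives, and \<open>complete\<close> provides a
  constant representative of each Cauchy class.\<close>

locale complete_space =
  fixes X :: "'v snspace"
  assumes add_closed: "x \<in> vecs X \<Longrightarrow> y \<in> vecs X \<Longrightarrow> vadd X x y \<in> vecs X"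
    and scale_closed: "x \<in> vecs X \<Longrightarrow> vscale X r x \<in> vecs X"
    and dist_eq_0: "x \<in> vecs X \<Longrightarrow> y \<in> vecs X \<Longrightarrow> vdist X x y = 0 \<longleftrightarrow> x = y"
    and dist_commute: "x \<in> vecs X \<Longrightarrow> y \<in> vecs X \<Longrightarrow> vdist X x y = vdist X y x"
    and dist_triangle: "x \<in> vecs X \<Longrightarrow> y \<in> vecs X \<Longrightarrow> z \<in> vecs X \<Longrightarrow>
      vdist X x z \<le> vdist X x y + vdist X y z"
    and dist_add: "x \<in> vecs X \<Longrightarrow> y \<in> vecs X \<Longrightarrow> x' \<in> vecs X \<Longrightarrow> y' \<in> vecs X \<Longrightarrow>
      vdist X (vadd X x y) (vadd X x' y') \<le> vdist X x x' + vdist X y y'"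
    and dist_scale: "x \<in> vecs X \<Longrightarrow> y \<in> vecs X \<Longrightarrow>
      vdist X (vscale X r x) (vscale X r y) \<le> \<bar>r\<bar> * vdist X x y"
    and norm_diff: "x \<in> vecs X \<Longrightarrow> y \<in> vecs X \<Longrightarrow> \<bar>vnorm X x - vnorm X y\<bar> \<le> vdist X x y"
    and complete: "s \<in> cauchy_seqs X \<Longrightarrow> \<exists>x\<in>vecs X. (\<lambda>n. vdist X x (s n)) \<longlonglongrightarrow> 0"
begin

lemma dist_nonneg: "x \<in> vecs X \<Longrightarrow> y \<in> vecs X \<Longrightarrow> 0 \<le> vdist X x y"
  using norm_diff[of x y] by linarith

lemma dist_tendsto_0:
  assumes "\<And>n. s n \<in> vecs X" "\<And>n. t n \<in> vecs X" "\<And>n. vdist X (s n) (t n) \<le> B n" "B \<longlonglongrightarrow> 0"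
  shows "(\<lambda>n. vdist X (s n) (t n)) \<longlonglongrightarrow> 0"
  using assms dist_nonneg by (intro tendsto_sandwich[OF _ _ tendsto_const assms(4)]) auto

section \<open>The quotient by a trivial kernel\<close>

lemma kernel_coset_eq: "x \<in> vecs X \<Longrightarrow> kernel_coset X x = {x}"
  using dist_eq_0 by (auto simp: kernel_coset_def)

lemma isometric_iso_quotient: "isometric_iso X (kernel_quotient X) (\<lambda>x. {x})"
  using kernel_coset_eq add_closed scale_closed
  by (auto simp: isometric_iso_def linear_iso_def kernel_quotient_def bij_betw_def inj_on_def image_iff)

lemma vecs_quotient: "vecs (kernel_quotient X) = (\<lambda>x. {x}) ` vecs X"
  using kernel_coset_eq by (auto simp: kernel_quotient_def)

lemma quotient_ops:
  assumes "x \<in> vecs X"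
  shows "vscale (kernel_quotient X) r {x} = {vscale X r x}"
    and "vnorm (kernel_quotient X) {x} = vnorm X x"
    and "y \<in> vecs X \<Longrightarrow> vadd (kernel_quotient X) {x} {y} = {vadd X x y}"
    and "y \<in> vecs X \<Longrightarrow> vdist (kernel_quotient X) {x} {y} = vdist X x y"
  using assms kernel_coset_eq add_closed scale_closed by (simp_all add: kernel_quotient_def vdist_def)

text \<open>All laws transfer along \<open>x\<close> to \<open>{x}\<close>, so that the results on
  completions apply to the quotient too.\<close>

lemma complete_quotient: "complete_space (kernel_quotient X)"
proof
  fix s assume s: "s \<in> cauchy_seqs (kernel_quotient X)"
  then have "\<forall>n. \<exists>x. s n = {x} \<and> x \<in> vecs X"
    unfolding cauchy_seqs_def vecs_quotient by blast
  then obtain t where t: "\<And>n. s n = {t n}" "\<And>n. t n \<in> vecs X" by metis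
  then have "t \<in> cauchy_seqs X"
    using s by (auto simp: cauchy_seqs_def quotient_ops)
  then obtain x where "x \<in> vecs X" "(\<lambda>n. vdist X x (t n)) \<longlonglongrightarrow> 0" using complete by blast
  then show "\<exists>x\<in>vecs (kernel_quotient X). (\<lambda>n. vdist (kernel_quotient X) x (s n)) \<longlonglongrightarrow> 0"
    using t by (auto simp: vecs_quotient quotient_ops)
qed (auto simp: vecs_quotient quotient_ops add_closed scale_closed dist_eq_0 dist_commute
    intro!: dist_triangle dist_add dist_scale norm_diff)

section \<open>The completion of a complete space\<close>

lemma convergent_cauchy:
  assumes "x \<in> vecs X" "\<And>n. s n \<in> vecs X" "(\<lambda>n. vdist X x (s n)) \<longlonglongrightarrow> 0"
  shows "s \<in> cauchy_seqs X"
  unfolding cauchy_seqs_def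
proof (intro CollectI conjI allI impI)
  fix e :: real assume "e > 0"
  then obtain N where N: "\<And>n. n \<ge> N \<Longrightarrow> vdist X x (s n) < e / 2"
    using LIMSEQ_D[OF assms(3), of "e / 2"] by fastforce
  have "vdist X (s m) (s n) < e" if "m \<ge> N" "n \<ge> N" for m n
    using dist_triangle[of "s m" x "s n"] dist_commute[of x "s m"] assms N[OF that(1)] N[OF that(2)]
    by fastforce
  then show "\<exists>N. \<forall>m\<ge>N. \<forall>n\<ge>N. vdist X (s m) (s n) < e" by blast
qed (use assms in auto)

text \<open>Convergence to \<open>x\<close> already forces the Cauchy condition, so only convergence
  has to be checked for membership.\<close>

lemma cauchy_class_const_iff:
  assumes "x \<in> vecs X"
  shows "t \<in> cauchy_class X (\<lambda>_. x) \<longleftrightarrow> (\<forall>n. t n \<in> vecs X) \<and> (\<lambda>n. vdist X x (t n)) \<longlonglongrightarrow> 0"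
  using convergent_cauchy[OF assms] by (auto simp: cauchy_class_def cauchy_seqs_def)

lemma const_in_cauchy_class: "x \<in> vecs X \<Longrightarrow> (\<lambda>_. x) \<in> cauchy_class X (\<lambda>_. x)"
  using dist_eq_0[of x x] by (simp add: cauchy_class_const_iff)

lemma limit_transfer:
  assumes "x \<in> vecs X" "\<And>n. s n \<in> vecs X" "\<And>n. t n \<in> vecs X"
    and "(\<lambda>n. vdist X x (s n)) \<longlonglongrightarrow> 0" "(\<lambda>n. vdist X (s n) (t n)) \<longlonglongrightarrow> 0"
  shows "(\<lambda>n. vdist X x (t n)) \<longlonglongrightarrow> 0"
proof (rule dist_tendsto_0[OF assms(1,3)])
  show "vdist X x (t n) \<le> vdist X x (s n) + vdist X (s n) (t n)" for n
    using assms by (intro dist_triangle)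
  show "(\<lambda>n. vdist X x (s n) + vdist X (s n) (t n)) \<longlonglongrightarrow> 0"
    using tendsto_add[OF assms(4,5)] by simp
qed

text \<open>Two sequences at vanishing distance have the same limits, by the triangle inequality.
  This is what makes operations on classes independent of representatives.\<close>

lemma cauchy_class_eq:
  assumes x: "x \<in> vecs X" and s: "s \<in> cauchy_class X (\<lambda>_. x)"
  shows "cauchy_class X s = cauchy_class X (\<lambda>_. x)"
proof (intro set_eqI iffI)
  have s': "s n \<in> vecs X" for n using s x by (simp add: cauchy_class_const_iff)
  have lim: "(\<lambda>n. vdist X x (s n)) \<longlonglongrightarrow> 0" using s x by (simp add: cauchy_class_const_iff)
  fix t
  {
    assume "t \<in> cauchy_class X s"
    then have "\<And>n. t n \<in> vecs X" "(\<lambda>n. vdist X (s n) (t n)) \<longlonglongrightarrow> 0"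
      by (auto simp: cauchy_class_def cauchy_seqs_def)
    with limit_transfer[OF x s' _ lim] show "t \<in> cauchy_class X (\<lambda>_. x)"
      using x by (simp add: cauchy_class_const_iff)
  next
    assume t: "t \<in> cauchy_class X (\<lambda>_. x)"
    then have t': "\<And>n. t n \<in> vecs X" and "(\<lambda>n. vdist X x (t n)) \<longlonglongrightarrow> 0"
      using x by (auto simp: cauchy_class_const_iff)
    then have "(\<lambda>n. vdist X (s n) x + vdist X x (t n)) \<longlonglongrightarrow> 0"
      using tendsto_add[OF lim] x s' by (simp add: dist_commute)
    then have "(\<lambda>n. vdist X (s n) (t n)) \<longlonglongrightarrow> 0"
      by (rule dist_tendsto_0[OF s' t' dist_triangle[OF s' x t']])
    then show "t \<in> cauchy_class X s"
      using t by (auto simp: cauchy_class_def)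
  }
qed

text \<open>Completeness enters here: a Cauchy sequence is equivalent to the constant sequence of
  its limit.\<close>

lemma vecs_completion: "vecs (completion X) = (\<lambda>x. cauchy_class X (\<lambda>_. x)) ` vecs X"
proof -
  have "cauchy_class X s \<in> (\<lambda>x. cauchy_class X (\<lambda>_. x)) ` vecs X" if s: "s \<in> cauchy_seqs X" for s
  proof -
    obtain x where x: "x \<in> vecs X" "(\<lambda>n. vdist X x (s n)) \<longlonglongrightarrow> 0" using complete[OF s] by blast
    then have "s \<in> cauchy_class X (\<lambda>_. x)"
      using s by (auto simp: cauchy_class_def)
    with x cauchy_class_eq show ?thesis by blast
  qed
  moreover have "(\<lambda>_. x) \<in> cauchy_seqs X" if "x \<in> vecs X" for x
    using const_in_cauchy_class[OF that] by (simp add: cauchy_class_def)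
  ultimately show ?thesis by (auto simp: completion_def)
qed

lemma completion_add:
  assumes x: "x \<in> vecs X" and y: "y \<in> vecs X"
  shows "vadd (completion X) (cauchy_class X (\<lambda>_. x)) (cauchy_class X (\<lambda>_. y)) =
    cauchy_class X (\<lambda>_. vadd X x y)"
proof -
  have "cauchy_class X (\<lambda>n. vadd X (s n) (t n)) = cauchy_class X (\<lambda>_. vadd X x y)"
    if s: "s \<in> cauchy_class X (\<lambda>_. x)" and t: "t \<in> cauchy_class X (\<lambda>_. y)" for s t
  proof (rule cauchy_class_eq)
    have *: "\<And>n. s n \<in> vecs X" "\<And>n. t n \<in> vecs X"
      and "(\<lambda>n. vdist X x (s n)) \<longlonglongrightarrow> 0" "(\<lambda>n. vdist X y (t n)) \<longlonglongrightarrow> 0"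
      using s t x y by (auto simp: cauchy_class_const_iff)
    then have "(\<lambda>n. vdist X x (s n) + vdist X y (t n)) \<longlonglongrightarrow> 0 + 0"
      by (intro tendsto_add)
    then have "(\<lambda>n. vdist X (vadd X x y) (vadd X (s n) (t n))) \<longlonglongrightarrow> 0"
      using * x y by (intro dist_tendsto_0[OF add_closed add_closed dist_add]) simp_all
    then show "(\<lambda>n. vadd X (s n) (t n)) \<in> cauchy_class X (\<lambda>_. vadd X x y)"
      using * x y add_closed by (simp add: cauchy_class_const_iff)
  qed (use x y add_closed in auto)
  \<comment> \<open>All members of the union over representatives coincide; the constant sequences
    show that the index sets are nonempty, so the union is that common class.\<close>
  then have "(\<Union>s\<in>cauchy_class X (\<lambda>_. x). \<Union>t\<in>cauchy_class X (\<lambda>_. y).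
      cauchy_class X (\<lambda>n. vadd X (s n) (t n))) =
      (\<Union>s\<in>cauchy_class X (\<lambda>_. x). \<Union>t\<in>cauchy_class X (\<lambda>_. y). cauchy_class X (\<lambda>_. vadd X x y))"
    by (intro SUP_cong refl)
  also have "\<dots> = cauchy_class X (\<lambda>_. vadd X x y)"
    using const_in_cauchy_class[OF x] const_in_cauchy_class[OF y] by blast
  finally show ?thesis by (simp add: completion_def)
qed

lemma completion_scale:
  assumes x: "x \<in> vecs X"
  shows "vscale (completion X) r (cauchy_class X (\<lambda>_. x)) = cauchy_class X (\<lambda>_. vscale X r x)"
proof -
  have "cauchy_class X (\<lambda>n. vscale X r (s n)) = cauchy_class X (\<lambda>_. vscale X r x)"
    if s: "s \<in> cauchy_class X (\<lambda>_. x)" for s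
  proof (rule cauchy_class_eq)
    have *: "\<And>n. s n \<in> vecs X" and "(\<lambda>n. vdist X x (s n)) \<longlonglongrightarrow> 0"
      using s x by (auto simp: cauchy_class_const_iff)
    then have "(\<lambda>n. \<bar>r\<bar> * vdist X x (s n)) \<longlonglongrightarrow> 0"
      using tendsto_mult_right_zero by blast
    then have "(\<lambda>n. vdist X (vscale X r x) (vscale X r (s n))) \<longlonglongrightarrow> 0"
      using * x by (intro dist_tendsto_0[OF scale_closed scale_closed dist_scale]) simp_all
    then show "(\<lambda>n. vscale X r (s n)) \<in> cauchy_class X (\<lambda>_. vscale X r x)"
      using * x scale_closed by (simp add: cauchy_class_const_iff)
  qed (use x scale_closed in auto)
  then have "(\<Union>s\<in>cauchy_class X (\<lambda>_. x). cauchy_class X (\<lambda>n. vscale X r (s n))) =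
      (\<Union>s\<in>cauchy_class X (\<lambda>_. x). cauchy_class X (\<lambda>_. vscale X r x))"
    by (intro SUP_cong refl)
  also have "\<dots> = cauchy_class X (\<lambda>_. vscale X r x)"
    using const_in_cauchy_class[OF x] by blast
  finally show ?thesis by (simp add: completion_def)
qed

lemma completion_norm:
  assumes x: "x \<in> vecs X"
  shows "vnorm (completion X) (cauchy_class X (\<lambda>_. x)) = vnorm X x"
proof -
  have "lim (\<lambda>n. vnorm X (s n)) = vnorm X x" if s: "s \<in> cauchy_class X (\<lambda>_. x)" for s
  proof (rule limI, rule LIM_zero_cancel, rule Lim_null_comparison)
    have s': "\<And>n. s n \<in> vecs X" and lim: "(\<lambda>n. vdist X x (s n)) \<longlonglongrightarrow> 0"
      using s x by (auto simp: cauchy_class_const_iff)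
    have "norm (vnorm X (s n) - vnorm X x) \<le> vdist X x (s n)" for n
      using norm_diff[OF x s'] by (simp add: abs_minus_commute)
    then show "\<forall>\<^sub>F n in sequentially. norm (vnorm X (s n) - vnorm X x) \<le> vdist X x (s n)" by simp
    show "(\<lambda>n. vdist X x (s n)) \<longlonglongrightarrow> 0" by (rule lim)
  qed
  then have "(\<lambda>s. lim (\<lambda>n. vnorm X (s n))) ` cauchy_class X (\<lambda>_. x) = {vnorm X x}"
    using const_in_cauchy_class[OF x] by force
  then show ?thesis by (simp add: completion_def)
qed

lemma isometric_iso_completion: "isometric_iso X (completion X) (\<lambda>x. cauchy_class X (\<lambda>_. x))"
proof -
  have "inj_on (\<lambda>x. cauchy_class X (\<lambda>_. x)) (vecs X)"
  proof (rule inj_onI)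
    fix x y assume x: "x \<in> vecs X" and y: "y \<in> vecs X"
      and eq: "cauchy_class X (\<lambda>_. x) = cauchy_class X (\<lambda>_. y)"
    have "(\<lambda>_. y) \<in> cauchy_class X (\<lambda>_. x)"
      unfolding eq using y by (rule const_in_cauchy_class)
    then show "x = y"
      using x y by (simp add: cauchy_class_const_iff LIMSEQ_const_iff dist_eq_0)
  qed
  then show ?thesis
    by (simp add: isometric_iso_def linear_iso_def bij_betw_def vecs_completion
        completion_add completion_scale completion_norm)
qed

lemma isometric_iso_completion_quotient:
  "\<exists>J. isometric_iso X (completion (kernel_quotient X)) J"
  using isometric_iso_comp[OF isometric_iso_quotient
      complete_space.isometric_iso_completion[OF complete_quotient]] by blast

lemma linear_iso_inv:
  assumes "linear_iso X Y J"
  shows "linear_iso Y X (inv_into (vecs X) J)"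
proof -
  have bij: "bij_betw J (vecs X) (vecs Y)" using assms by (simp add: linear_iso_def)
  then have inj: "inj_on J (vecs X)" and Y: "vecs Y = J ` vecs X" by (auto simp: bij_betw_def)
  have inv: "inv_into (vecs X) J (J x) = x" if "x \<in> vecs X" for x
    using inj that by (rule inv_into_f_f)
  have "inv_into (vecs X) J (vadd Y (J x) (J y)) = vadd X x y" if "x \<in> vecs X" "y \<in> vecs X" for x y
    using assms that inv[OF add_closed[OF that]] by (simp add: linear_iso_def)
  moreover have "inv_into (vecs X) J (vscale Y r (J x)) = vscale X r x" if "x \<in> vecs X" for r x
    using assms that inv[OF scale_closed[OF that]] by (simp add: linear_iso_def)
  ultimately show ?thesis
    using bij_betw_inv_into[OF bij] inv by (simp add: linear_iso_def Y)
qed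

text \<open>Composing \<open>T\<close> with the inverse of the isometry from \<open>X\<close> onto
  the completion preserves both estimates.\<close>

lemma banach_mazur_completion_le:
  assumes T: "linear_iso X Z T"
    and "\<And>x. x \<in> vecs X \<Longrightarrow> vnorm Z (T x) \<le> a * vnorm X x"
    and "\<And>x. x \<in> vecs X \<Longrightarrow> vnorm X x \<le> b * vnorm Z (T x)"
    and "0 \<le> a" "0 \<le> b"
  shows "banach_mazur (completion (kernel_quotient X)) Z \<le> ennreal (a * b)"
proof -
  let ?Y = "completion (kernel_quotient X)"
  obtain J where J: "isometric_iso X ?Y J" using isometric_iso_completion_quotient by blast
  then have lin: "linear_iso X ?Y J" and norm: "\<And>x. x \<in> vecs X \<Longrightarrow> vnorm ?Y (J x) = vnorm X x"
    by (auto simp: isometric_iso_def)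
  have Y: "vecs ?Y = J ` vecs X" and inj: "inj_on J (vecs X)"
    using lin by (auto simp: linear_iso_def bij_betw_def)
  show ?thesis
    using assms norm inj
    by (intro banach_mazur_le[OF linear_iso_comp[OF linear_iso_inv[OF lin] T]]) (auto simp: Y)
qed

end


section \<open>The double-point norm of a tree\<close>

lemma linf_norm_ge: "i < n \<Longrightarrow> \<bar>a i\<bar> \<le> vnorm (linf n) a"
  by (auto simp: linf_def function_space_def intro!: Max_ge)

lemma linf_norm_le: "0 \<le> B \<Longrightarrow> (\<And>i. i < n \<Longrightarrow> \<bar>a i\<bar> \<le> B) \<Longrightarrow> vnorm (linf n) a \<le> B"
  by (auto simp: linf_def function_space_def)

text \<open>What the norm estimates take from the tree: on a finite nonempty set, the potential is a
  bijection modulo constants.\<close>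

locale potential_space =
  fixes V :: "'a set" and d :: "'a \<Rightarrow> 'a \<Rightarrow> real"
  assumes fin: "finite V" and nonempty: "V \<noteq> {}"
    and inj: "sum f V = 0 \<Longrightarrow> (\<And>v. v \<in> V \<Longrightarrow> potential V d f v = c) \<Longrightarrow> x \<in> V \<Longrightarrow> f x = 0"
    and surj: "\<exists>f c. sum f V = 0 \<and> (\<forall>v\<in>V. potential V d f v = h v + c)"
begin

abbreviation "dp_space \<equiv> function_space (TP V) (dp_norm V d)"

abbreviation "pot \<equiv> potential V d"

lemma TP_add: "f \<in> TP V \<Longrightarrow> g \<in> TP V \<Longrightarrow> (\<lambda>x. f x + g x) \<in> TP V"
  by (auto simp: TP_iff[OF fin] sum.distrib)

lemma TP_scale: "f \<in> TP V \<Longrightarrow> (\<lambda>x. r * f x) \<in> TP V"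
  by (auto simp: TP_iff[OF fin] sum_distrib_left[symmetric])

lemma dp_space_simps:
  "vecs dp_space = TP V" "vadd dp_space f g = (\<lambda>x. f x + g x)" "vscale dp_space r f = (\<lambda>x. r * f x)"
  "vnorm dp_space = dp_norm V d"
  by (simp_all add: function_space_def)

text \<open>With \<open>dp_dist_le\<close> this reduces the metric laws of \<open>dp_space\<close>
  to linear arithmetic with four values of potentials for each pair of points.\<close>

lemma dp_dist_ge:
  assumes "f \<in> TP V" "g \<in> TP V" "u \<in> V" "v \<in> V"
  shows "\<bar>(pot f v - pot g v) - (pot f u - pot g u)\<bar> \<le> 2 * vdist dp_space f g"
  using dp_norm_ge[OF fin TP_add[OF assms(1) TP_scale[OF assms(2), of "-1"]] assms(3,4), of d]
  unfolding vdist_def dp_space_simps potential_add potential_scale by simp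

lemma dp_dist_le:
  assumes "f \<in> TP V" "g \<in> TP V"
    and "\<And>u v. u \<in> V \<Longrightarrow> v \<in> V \<Longrightarrow> \<bar>(pot f v - pot g v) - (pot f u - pot g u)\<bar> \<le> 2 * B"
  shows "vdist dp_space f g \<le> B"
  unfolding vdist_def dp_space_simps
proof (rule dp_norm_le[OF fin nonempty TP_add[OF assms(1) TP_scale[OF assms(2)]]])
  fix u v assume "u \<in> V" "v \<in> V"
  from assms(3)[OF this] show "\<bar>pot (\<lambda>x. f x + -1 * g x) v - pot (\<lambda>x. f x + -1 * g x) u\<bar> \<le> 2 * B"
    unfolding potential_add potential_scale by simp
qed

lemma TP_eqI:
  assumes "f \<in> TP V" "g \<in> TP V" "\<And>u v. u \<in> V \<Longrightarrow> v \<in> V \<Longrightarrow> pot f v - pot f u = pot g v - pot g u"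
  shows "f = g"
proof
  fix x
  obtain z where z: "z \<in> V" using nonempty by auto
  let ?h = "\<lambda>x. f x + -1 * g x"
  have h: "?h \<in> TP V" using assms by (intro TP_add TP_scale)
  show "f x = g x"
  proof (cases "x \<in> V")
    case True
    have "?h x = 0"
    proof (rule inj[OF _ _ True])
      show "sum ?h V = 0" using h by (simp add: TP_iff[OF fin])
      show "pot ?h v = pot f z - pot g z" if "v \<in> V" for v
        unfolding potential_add potential_scale using assms(3)[OF z that] by simp
    qed
    then show ?thesis by simp
  next
    case False
    then show ?thesis using assms by (auto simp: TP_iff[OF fin])
  qed
qed

lemma TP_potential:
  obtains f where "f \<in> TP V" "\<And>u v. u \<in> V \<Longrightarrow> v \<in> V \<Longrightarrow> pot f v - pot f u = h v - h u"
proof -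
  obtain f c where f: "sum f V = 0" "\<And>v. v \<in> V \<Longrightarrow> pot f v = h v + c" using surj by metis
  \<comment> \<open>Elements of \<open>TP V\<close> vanish outside \<open>V\<close>; cutting off
    there does not affect the potential, which only sums over \<open>V\<close>.\<close>
  let ?f = "\<lambda>x. if x \<in> V then f x else 0"
  have "?f \<in> TP V" using f by (simp add: TP_iff[OF fin])
  moreover have "pot ?f v = pot f v" for v unfolding potential_def by (rule sum.cong) auto
  ultimately show thesis using that[of ?f] f by simp
qed

text \<open>The limit is built on the side of potentials: normalised at \<open>z\<close> they
  converge at each vertex, and surjectivity provides an element of \<open>TP V\<close> with the
  limit as its potential up to a constant.\<close>

lemma dp_complete:
  assumes s: "s \<in> cauchy_seqs dp_space"
  shows "\<exists>f\<in>TP V. (\<lambda>n. vdist dp_space f (s n)) \<longlonglongrightarrow> 0"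
proof -
  obtain z where z: "z \<in> V" using nonempty by auto
  have sTP: "s n \<in> TP V" for n using s by (simp add: cauchy_seqs_def dp_space_simps)
  have "convergent (\<lambda>n. pot (s n) v - pot (s n) z)" if v: "v \<in> V" for v
    unfolding Cauchy_convergent_iff[symmetric]
  proof (rule CauchyI)
    fix e :: real assume "e > 0"
    then have "\<exists>N. \<forall>m\<ge>N. \<forall>n\<ge>N. vdist dp_space (s m) (s n) < e / 2"
      using s half_gt_zero unfolding cauchy_seqs_def by blast
    then obtain N where N: "\<And>m n. m \<ge> N \<Longrightarrow> n \<ge> N \<Longrightarrow> vdist dp_space (s m) (s n) < e / 2" by blast
    have "\<bar>(pot (s m) v - pot (s m) z) - (pot (s n) v - pot (s n) z)\<bar> < e" if "m \<ge> N" "n \<ge> N" for m n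
      using dp_dist_ge[OF sTP[of m] sTP[of n] z v] N[OF that] by linarith
    then show "\<exists>N. \<forall>m\<ge>N. \<forall>n\<ge>N. norm ((pot (s m) v - pot (s m) z) - (pot (s n) v - pot (s n) z)) < e"
      by auto
  qed
  moreover define h where "h v = lim (\<lambda>n. pot (s n) v - pot (s n) z)" for v
  ultimately have h: "(\<lambda>n. pot (s n) v - pot (s n) z) \<longlonglongrightarrow> h v" if "v \<in> V" for v
    using that by (simp add: convergent_LIMSEQ_iff)
  obtain f where f: "f \<in> TP V" "\<And>u v. u \<in> V \<Longrightarrow> v \<in> V \<Longrightarrow> pot f v - pot f u = h v - h u"
    using TP_potential[of h] by blast
  \<comment> \<open>Finiteness of \<open>V\<close> makes this sum of errors tend to 0. It dominates
    the error at each vertex, so a difference of two errors is at most \<open>2 * B n\<close>, as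
    \<open>dp_dist_le\<close> asks.\<close>
  define B where "B n = (\<Sum>v\<in>V. \<bar>pot (s n) v - pot (s n) z - h v\<bar>)" for n
  have "B \<longlonglongrightarrow> (\<Sum>v\<in>V. \<bar>h v - h v\<bar>)"
    unfolding B_def using h by (intro tendsto_intros) auto
  then have B: "B \<longlonglongrightarrow> 0" by simp
  have upper: "vdist dp_space f (s n) \<le> B n" for n
  proof (rule dp_dist_le[OF f(1) sTP])
    fix u v assume uv: "u \<in> V" "v \<in> V"
    have "\<bar>pot (s n) v - pot (s n) z - h v\<bar> \<le> B n" if "v \<in> V" for v
      unfolding B_def using that fin by (intro member_le_sum) auto
    from this[OF uv(1)] this[OF uv(2)] f(2)[OF uv]
    show "\<bar>(pot f v - pot (s n) v) - (pot f u - pot (s n) u)\<bar> \<le> 2 * B n" by linarith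
  qed
  have lower: "0 \<le> vdist dp_space f (s n)" for n
    using dp_dist_ge[OF f(1) sTP z z, of n] by simp
  have "(\<lambda>n. vdist dp_space f (s n)) \<longlonglongrightarrow> 0"
    using upper lower by (intro tendsto_sandwich[OF _ _ tendsto_const B]) auto
  with f show ?thesis by blast
qed

lemma complete_space_dp: "complete_space dp_space"
proof (unfold_locales; (unfold dp_space_simps)?)
  fix f g assume f: "f \<in> TP V" and g: "g \<in> TP V"
  show "(\<lambda>x. f x + g x) \<in> TP V" using f g by (rule TP_add)
  show "(\<lambda>x. r * f x) \<in> TP V" for r using f by (rule TP_scale)
  show "vdist dp_space f g = 0 \<longleftrightarrow> f = g"
  proof
    assume "vdist dp_space f g = 0"
    then have "pot f v - pot f u = pot g v - pot g u" if "u \<in> V" "v \<in> V" for u v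
      using dp_dist_ge[OF f g that] by simp
    then show "f = g" by (rule TP_eqI[OF f g])
  next
    assume "f = g"
    moreover obtain z where "z \<in> V" using nonempty by auto
    ultimately show "vdist dp_space f g = 0"
      using dp_dist_le[OF f g, of 0] dp_dist_ge[OF f g, of z z] by simp
  qed
  have le: "vdist dp_space f g \<le> vdist dp_space g f" if "f \<in> TP V" "g \<in> TP V" for f g
  proof (rule dp_dist_le[OF that])
    fix u v assume "u \<in> V" "v \<in> V"
    from dp_dist_ge[OF that(2,1) this]
    show "\<bar>(pot f v - pot g v) - (pot f u - pot g u)\<bar> \<le> 2 * vdist dp_space g f" by linarith
  qed
  show "vdist dp_space f g = vdist dp_space g f" using le[OF f g] le[OF g f] by simp
  show "vdist dp_space (\<lambda>x. r * f x) (\<lambda>x. r * g x) \<le> \<bar>r\<bar> * vdist dp_space f g" for r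
  proof (rule dp_dist_le[OF TP_scale[OF f] TP_scale[OF g]])
    fix u v assume "u \<in> V" "v \<in> V"
    from mult_left_mono[OF dp_dist_ge[OF f g this] abs_ge_zero[of r]]
    show "\<bar>(pot (\<lambda>x. r * f x) v - pot (\<lambda>x. r * g x) v) - (pot (\<lambda>x. r * f x) u - pot (\<lambda>x. r * g x) u)\<bar>
        \<le> 2 * (\<bar>r\<bar> * vdist dp_space f g)"
      unfolding potential_scale abs_mult[symmetric] by (simp add: algebra_simps)
  qed
  have norm_le: "dp_norm V d f \<le> dp_norm V d g + vdist dp_space f g" if "f \<in> TP V" "g \<in> TP V" for f g
  proof (rule dp_norm_le[OF fin nonempty that(1)])
    fix u v assume "u \<in> V" "v \<in> V"
    from dp_dist_ge[OF that this] dp_norm_ge[OF fin that(2) this, of d]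
    show "\<bar>pot f v - pot f u\<bar> \<le> 2 * (dp_norm V d g + vdist dp_space f g)"
      unfolding distrib_left by linarith
  qed
  show "\<bar>dp_norm V d f - dp_norm V d g\<bar> \<le> vdist dp_space f g"
    using norm_le[OF f g] norm_le[OF g f] le[OF g f] by linarith
  fix h assume h: "h \<in> TP V"
  show "vdist dp_space f h \<le> vdist dp_space f g + vdist dp_space g h"
  proof (rule dp_dist_le[OF f h])
    fix u v assume "u \<in> V" "v \<in> V"
    from dp_dist_ge[OF f g this] dp_dist_ge[OF g h this]
    show "\<bar>(pot f v - pot h v) - (pot f u - pot h u)\<bar> \<le> 2 * (vdist dp_space f g + vdist dp_space g h)"
      unfolding distrib_left by linarith
  qed
  fix k assume k: "k \<in> TP V"
  show "vdist dp_space (\<lambda>x. f x + g x) (\<lambda>x. h x + k x) \<le> vdist dp_space f h + vdist dp_space g k"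
  proof (rule dp_dist_le[OF TP_add[OF f g] TP_add[OF h k]])
    fix u v assume "u \<in> V" "v \<in> V"
    from dp_dist_ge[OF f h this] dp_dist_ge[OF g k this]
    show "\<bar>(pot (\<lambda>x. f x + g x) v - pot (\<lambda>x. h x + k x) v) -
        (pot (\<lambda>x. f x + g x) u - pot (\<lambda>x. h x + k x) u)\<bar> \<le> 2 * (vdist dp_space f h + vdist dp_space g k)"
      unfolding potential_add distrib_left by linarith
  qed
qed (rule dp_complete)

lemma banach_mazur_TP_DP_le: "banach_mazur (TP_DP V d) (linf (card V - 1)) \<le> 2"
proof -
  obtain z where z: "z \<in> V" using nonempty by auto
  define n where "n = card V - 1"
  have "card (V - {z}) = n" using z fin by (simp add: n_def)
  then obtain b where b: "bij_betw b {..<n} (V - {z})"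
    using ex_bij_betw_nat_finite[of "V - {z}"] fin by (auto simp: atLeast0LessThan)
  then have bV: "b i \<in> V" if "i < n" for i
    using that by (auto dest: bij_betwE)
  have V_cases: "v = z \<or> (\<exists>i<n. v = b i)" if "v \<in> V" for v
    using b that by (auto simp: bij_betw_def image_iff set_eq_iff)
  \<comment> \<open>With the half, each coordinate is up to sign one of the terms in the supremum,
    for the pair \<open>z\<close>, \<open>b i\<close>; hence the constant 1 in the first
    estimate.\<close>
  define T where "T f = (\<lambda>i. if i < n then (pot f (b i) - pot f z) / 2 else 0)" for f
  have linf_simps: "vecs (linf n) = {a. \<forall>i\<ge>n. a i = 0}" "vadd (linf n) f g = (\<lambda>x. f x + g x)"
    "vscale (linf n) r f = (\<lambda>x. r * f x)" for f g r
    by (simp_all add: linf_def function_space_def)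
  have "inj_on T (TP V)"
  proof (rule inj_onI)
    fix f g assume fg: "f \<in> TP V" "g \<in> TP V" and eq: "T f = T g"
    have *: "pot f v - pot f z = pot g v - pot g z" if "v \<in> V" for v
      using V_cases[OF that]
    proof (elim disjE exE conjE)
      fix i assume "i < n" "v = b i"
      with fun_cong[OF eq, of i] show ?thesis by (simp add: T_def)
    qed simp
    have "pot f v - pot f u = pot g v - pot g u" if "u \<in> V" "v \<in> V" for u v
      using *[OF that(1)] *[OF that(2)] by linarith
    with fg show "f = g" by (rule TP_eqI)
  qed
  moreover have "T ` TP V = {a. \<forall>i\<ge>n. a i = 0}"
  proof (intro subset_antisym subsetI)
    fix a :: "nat \<Rightarrow> real" assume a: "a \<in> {a. \<forall>i\<ge>n. a i = 0}"
    \<comment> \<open>The factor 2 undoes the half in \<open>T\<close>, and the value 0 at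
      \<open>z\<close> is the normalisation at the root.\<close>
    define h where "h v = (if v = z then 0 else 2 * a (inv_into {..<n} b v))" for v
    obtain f where f: "f \<in> TP V" "\<And>u v. u \<in> V \<Longrightarrow> v \<in> V \<Longrightarrow> pot f v - pot f u = h v - h u"
      using TP_potential[of h] by blast
    have "h (b i) = 2 * a i" if "i < n" for i
      using b that by (auto simp: h_def bij_betw_def)
    then have "T f = a"
      using f(2)[OF z bV] a by (auto simp: T_def h_def[of z] fun_eq_iff)
    with f show "a \<in> T ` TP V" by blast
  qed (auto simp: T_def)
  ultimately have lin: "linear_iso dp_space (linf n) T"
    by (auto simp: linear_iso_def bij_betw_def dp_space_simps linf_simps T_def potential_add
        potential_scale fun_eq_iff field_simps)
  have nonneg: "0 \<le> dp_norm V d f" if "f \<in> TP V" for f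
    using dp_norm_ge[OF fin that z z, of d] by simp
  have "banach_mazur (TP_DP V d) (linf n) \<le> ennreal (1 * 2)"
    unfolding TP_DP_def
  proof (rule complete_space.banach_mazur_completion_le[OF complete_space_dp lin])
    fix f assume "f \<in> vecs dp_space"
    then have f: "f \<in> TP V" by (simp add: dp_space_simps)
    show "vnorm (linf n) (T f) \<le> 1 * vnorm dp_space f"
      unfolding dp_space_simps
    proof (rule linf_norm_le)
      fix i assume "i < n"
      with dp_norm_ge[OF fin f z bV[OF this], of d] show "\<bar>T f i\<bar> \<le> 1 * dp_norm V d f"
        by (simp add: T_def)
    qed (use nonneg f in simp)
    show "vnorm dp_space f \<le> 2 * vnorm (linf n) (T f)"
      unfolding dp_space_simps
    proof (rule dp_norm_le[OF fin nonempty f])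
      \<comment> \<open>A difference between two arbitrary vertices splits at the root
        \<open>z\<close> into two such differences; this is the source of the constant 2.\<close>
      have *: "\<bar>pot f v - pot f z\<bar> \<le> 2 * vnorm (linf n) (T f)" if v: "v \<in> V" for v
      proof (cases "v = z")
        case True
        \<comment> \<open>The root is not a coordinate. Here the 0 inserted under \<open>Max\<close>
          gives the bound, also when \<open>n = 0\<close>.\<close>
        have "0 \<le> vnorm (linf n) (T f)"
          by (auto simp: linf_def function_space_def intro!: Max_ge)
        with True show ?thesis by simp
      next
        case False
        then obtain i where "i < n" "v = b i" using V_cases[OF v] by auto
        then show ?thesis using linf_norm_ge[of i n "T f"] by (simp add: T_def)
      qed
      fix u v assume "u \<in> V" "v \<in> V"
      from *[OF this(1)] *[OF this(2)]
      show "\<bar>pot f v - pot f u\<bar> \<le> 2 * (2 * vnorm (linf n) (T f))" by linarith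
    qed
  qed simp_all
  then show ?thesis by (simp add: n_def)
qed

end

theorem proposition5p1:
  fixes V :: "'a set" and E :: "'a set set" and w :: "'a set \<Rightarrow> real"
  assumes "finite_tree V E"
    and "\<And>e. e \<in> E \<Longrightarrow> w e > 0"
  shows "banach_mazur (TP_DP V (tree_dist V E w)) (linf (card E)) \<le> 4"
proof -
  have "potential_space V (tree_dist V E w)"
  proof
    show "finite V" "V \<noteq> {}" using assms(1) by (auto simp: finite_tree_def finite_graph_def)
    show "f x = 0" if "sum f V = 0" "\<And>v. v \<in> V \<Longrightarrow> potential V (tree_dist V E w) f v = c" "x \<in> V" for f c x
      using tree_potential_inj[OF assms that] .
    show "\<exists>f c. sum f V = 0 \<and> (\<forall>v\<in>V. potential V (tree_dist V E w) f v = h v + c)" for h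
      using tree_potential_surj[OF assms] .
  qed
  from potential_space.banach_mazur_TP_DP_le[OF this]
  have "banach_mazur (TP_DP V (tree_dist V E w)) (linf (card E)) \<le> 2"
    using card_tree[OF assms(1)] by simp
  also have "(2 :: ennreal) \<le> 4" by simp
  finally show ?thesis .
qed

end
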